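(* Let $n$ be a positive integer such that $2n+1$ is a prime number. Then the matrices $M_n(2), M_n(2)^2,\dots,M_n(2)^n$ are strongly independent over $\mathbb{Z}^n\setminus\{0\}$.
   Context: For a positive integer $n$ and a real number $a$, $M_n(a)$ denotes the $n\times n$ tridiagonal matrix whose diagonal entries are all $a$ except for the last one (position $(n,n)$), which is $a-1$, whose entries immediately above and immediately below the diagonal are all $1$, and whose other entries are $0$; in particular $M_1(a)=[a-1]$ and $M_2(a)=\begin{bmatrix}a&1\\1&a-1\end{bmatrix}$. $GL(n,\mathbb{Z})$ is the set of $n\times n$ integer matrices that are invertible with integer inverse. Matrices $B_1,\dots,B_n\in GL(n,\mathbb{Z})$ are called strongly independent over $\mathbb{Z}^n\setminus\{0\}$ if for every nonzero row vector $\vec{k}\in\mathbb{Z}^n$ the vectors $\vec{k}B_1,\dots,\vec{k}B_n$ are linearly independent over $\mathbb{R}$. (The claim includes that the listed matrices belong to $GL(n,\mathbb{Z})$.) *)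

theory Defs
  imports
    "HOL-Computational_Algebra.Primes"
    "Jordan_Normal_Form.VS_Connect"
begin

text \<open>Matrices and vectors are those of Jordan_Normal_Form, so indices run over
  0, ..., n - 1 and the last diagonal position is (n - 1, n - 1).  The scalar type is kept
  polymorphic: the matrix can be formed for real \<open>a\<close>, and for integer \<open>a\<close> it can be taken
  directly as an integer matrix; \<open>tridiag_M_of_int\<close> below shows that the two agree.\<close>

definition tridiag_M :: "nat \<Rightarrow> 'a::ring_1 \<Rightarrow> 'a mat" where
  "tridiag_M n a = mat n n (\<lambda>(i, j).
     if i = j then (if i = n - 1 then a - 1 else a)
     else if j = i + 1 \<or> i = j + 1 then 1
     else 0)"

lemma tridiag_M_of_int:
  "map_mat real_of_int (tridiag_M n a) = tridiag_M n (real_of_int a)"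
  by (rule eq_matI) (auto simp: tridiag_M_def)

definition GL_int :: "nat \<Rightarrow> int mat set" where
  "GL_int n = {A \<in> carrier_mat n n. invertible_mat A}"

text \<open>Row vector times matrix, the counterpart of \<open>mult_mat_vec\<close>.\<close>

definition row_vec_mult :: "'a::semiring_0 vec \<Rightarrow> 'a mat \<Rightarrow> 'a vec" where
  "row_vec_mult k A = vec (dim_col A) (\<lambda>j. k \<bullet> col A j)"

text \<open>Linear independence of a family of vectors in \<open>\<real>\<^sup>n\<close>.  The library's notion
  concerns sets of vectors, hence the injectivity requirement.\<close>

definition real_lin_indpt_family :: "nat \<Rightarrow> 'i set \<Rightarrow> ('i \<Rightarrow> real vec) \<Rightarrow> bool" where
  "real_lin_indpt_family n I v \<longleftrightarrow>
     inj_on v I \<and>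
     \<not> LinearCombinations.module.lin_dep class_ring (module_vec TYPE(real) n) (v ` I)"

definition strongly_independent :: "nat \<Rightarrow> (nat \<Rightarrow> int mat) \<Rightarrow> bool" where
  "strongly_independent n B \<longleftrightarrow>
     (\<forall>i\<in>{1..n}. B i \<in> GL_int n) \<and>
     (\<forall>k\<in>carrier_vec n. k \<noteq> 0\<^sub>v n \<longrightarrow>
        real_lin_indpt_family n {1..n} (\<lambda>i. map_vec real_of_int (row_vec_mult k (B i))))"

end

theory Submission
  imports
    Defs
    "HOL-Computational_Algebra.Polynomial_Factorial"
begin

text \<open>Put \<open>p = 2n + 1\<close>, \<open>M = M\<^sub>n(2)\<close>, and \<open>N = M - 4 = M\<^sub>n(-2)\<close>.  The recursion
  \<open>W\<^sub>0 = 1\<close>, \<open>W\<^sub>1 = y + 3\<close>, \<open>W\<^sub>j\<^sub>+\<^sub>2 = (y + 2) W\<^sub>j\<^sub>+\<^sub>1 - W\<^sub>j\<close> mirrors the tridiagonal shape of \<open>N\<close>: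
  \<open>W\<^sub>j(N) e\<^sub>0 = e\<^sub>j + e\<^sub>j\<^sub>-\<^sub>1\<close> for \<open>j < n\<close>, while the last diagonal entry makes \<open>W\<^sub>n(N) e\<^sub>0 = 0\<close>.  As
  \<open>e\<^sub>0\<close> is cyclic, \<open>W\<^sub>n(N) = 0\<close>.  The coefficients satisfy \<open>(2k + 1) [y\<^sup>k] W\<^sub>n = p (n + k choose 2k)\<close>,
  so \<open>W\<^sub>n\<close> is an Eisenstein polynomial at \<open>p\<close>, hence prime in \<open>\<int>[y]\<close>, and so is \<open>W\<^sub>n(x - 4)\<close>.
  Therefore a nonzero \<open>v \<in> \<int>\<^sup>n\<close> is killed by no \<open>q(M)\<close> with \<open>0 \<noteq> q \<in> \<int>[x]\<close> of degree less
  than \<open>n\<close>: a nonzero \<open>f\<close> of least degree with \<open>f(M) v = 0\<close> divides a constant multiple of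
  \<open>W\<^sub>n(x - 4)\<close>, which is prime of larger degree, so \<open>f\<close> would be constant.  Since \<open>M\<close> is
  invertible and symmetric, the integer matrix with columns \<open>M\<^sup>i v\<close>, \<open>1 \<le> i \<le> n\<close>, has nonzero
  determinant.\<close>

section \<open>Eisenstein's criterion over the integers, and irreducibility under a shift of the
  variable\<close>

text \<open>Since \<open>p\<^sup>2\<close> does not divide the constant term, some factor
  \<open>h\<close> of \<open>f = g * h\<close> has constant term prime to \<open>p\<close>. Modulo
  \<open>p\<close>, the first nonzero coefficient of \<open>g\<close> then gives a nonzero
  coefficient of \<open>f\<close>, which can only be the leading one; so \<open>g\<close> takes up
  the whole degree.\<close>

lemma eisenstein_irreducible:
  fixes f :: "int poly" and p :: int
  assumes p: "prime p" and monic: "lead_coeff f = 1" and deg: "degree f > 0"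
    and dvd: "\<And>i. i < degree f \<Longrightarrow> p dvd coeff f i" and f0: "\<not> p\<^sup>2 dvd coeff f 0"
  shows "irreducible f"
proof -
  have unit: "is_unit h" if f: "f = g * h" and h0: "\<not> p dvd coeff h 0" for g h
  proof -
    have "lead_coeff g * lead_coeff h = 1"
      using monic by (simp add: f lead_coeff_mult)
    then have units: "is_unit (lead_coeff g)" "is_unit (lead_coeff h)"
      by (metis dvd_triv_left dvd_triv_right)+
    then have ng: "\<not> p dvd lead_coeff g"
      using p by (meson dvd_trans not_prime_unit)
    define m where "m = (LEAST i. \<not> p dvd coeff g i)"
    have m: "\<not> p dvd coeff g m" and less: "\<And>i. i < m \<Longrightarrow> p dvd coeff g i"
      unfolding m_def using ng by (rule LeastI, use not_less_Least in blast)
    \<comment> \<open>All terms but the last contain some \<open>coeff g i\<close> with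
      \<open>i < m\<close>, so they vanish modulo \<open>p\<close>.\<close>
    have "coeff f m = (\<Sum>i<m. coeff g i * coeff h (m - i)) + coeff g m * coeff h 0"
      unfolding f coeff_mult by (simp flip: lessThan_Suc_atMost)
    moreover have "p dvd (\<Sum>i<m. coeff g i * coeff h (m - i))"
      by (intro dvd_sum dvd_mult2 less) auto
    moreover have "\<not> p dvd coeff g m * coeff h 0"
      using m h0 p by (simp add: prime_dvd_mult_iff)
    ultimately have "\<not> p dvd coeff f m"
      by (simp add: dvd_add_right_iff)
    then have "degree f \<le> m"
      using dvd not_less by blast
    moreover have "m \<le> degree g"
      unfolding m_def using ng by (rule Least_le)
    moreover have "degree f = degree g + degree h"
      using deg unfolding f by (intro degree_mult_eq) auto
    ultimately have "degree h = 0" by simp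
    then show ?thesis
      using units(2) by (auto elim!: degree_eq_zeroE simp: is_unit_const_poly_iff)
  qed
  show ?thesis
  proof (rule irreducibleI)
    show "f \<noteq> 0" using deg by auto
    show "\<not> is_unit f" using deg by (auto simp: is_unit_poly_iff)
    fix g h assume f: "f = g * h"
    have "\<not> p\<^sup>2 dvd coeff g 0 * coeff h 0" using f0 by (simp add: f coeff_mult)
    then have "\<not> p dvd coeff g 0 \<or> \<not> p dvd coeff h 0"
      unfolding power2_eq_square using mult_dvd_mono by blast
    then show "is_unit g \<or> is_unit h"
      using unit[of g h] unit[of h g] f by (auto simp: mult.commute)
  qed
qed

text \<open>Shifting by \<open>a\<close> inverts shifting by \<open>-a\<close>, and both respect
  products; so factorizations and units carry over in both directions.\<close>

lemma irreducible_pcompose_shift: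
  fixes f :: "'a::idom poly"
  assumes "irreducible f"
  shows "irreducible (pcompose f [:-a, 1:])"
proof -
  have inv: "pcompose (pcompose g [:a, 1:]) [:-a, 1:] = g" "pcompose (pcompose g [:-a, 1:]) [:a, 1:] = g"
    for g :: "'a poly"
    by (simp_all add: pcompose_pCons flip: pcompose_assoc)
  have unit: "(pcompose g c) dvd 1" if g: "g dvd 1" for g c :: "'a poly"
  proof -
    obtain k where "1 = g * k" using g by (elim dvdE)
    then have "1 = pcompose g c * pcompose k c"
      by (metis pcompose_1 pcompose_mult)
    then show ?thesis by (rule dvdI)
  qed
  show ?thesis
  proof (rule irreducibleI)
    show "pcompose f [:-a, 1:] \<noteq> 0"
      using inv(2)[of f] assms by (metis irreducible_def pcompose_0)
    show "\<not> (pcompose f [:-a, 1:]) dvd 1"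
      using inv(2)[of f] assms unit by (metis irreducible_not_unit)
    fix g h assume "pcompose f [:-a, 1:] = g * h"
    then have "f = pcompose g [:a, 1:] * pcompose h [:a, 1:]"
      by (metis inv(2) pcompose_mult)
    then have "(pcompose g [:a, 1:]) dvd 1 \<or> (pcompose h [:a, 1:]) dvd 1"
      using assms by (simp add: irreducibleD)
    then show "g dvd 1 \<or> h dvd 1"
      using unit inv(1) by metis
  qed
qed

section \<open>Irreducibility of the Chebyshev-type polynomial \<open>W\<^sub>n\<close>\<close>

text \<open>Chebyshev polynomials: \<open>cheb_W n\<close> at \<open>2 cos \<theta> - 2\<close> is \<open>sin ((n + 1/2) \<theta>) / sin (\<theta>/2)\<close>.\<close>

fun cheb_W :: "nat \<Rightarrow> int poly" where
  "cheb_W 0 = 1"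
| "cheb_W (Suc 0) = [:3, 1:]"
| "cheb_W (Suc (Suc n)) = [:2, 1:] * cheb_W (Suc n) - cheb_W n"

lemma coeff_cheb_W: "coeff (cheb_W n) k = int ((n + k) choose (2 * k)) + 2 * int ((n + k) choose (2 * k + 1))"
proof (induction n arbitrary: k rule: cheb_W.induct)
  case 1
  then show ?case by (cases k) (auto simp: binomial_eq_0)
next
  case 2
  then show ?case
    by (cases k rule: nat.exhaust; cases "k - 1") (auto simp: binomial_eq_0 numeral_2_eq_2 coeff_pCons split: nat.splits)
next
  case (3 n)
  show ?case
  proof (cases k)
    case 0
    then show ?thesis using 3 by simp
  next
    case (Suc j)
    \<comment> \<open>Pascal's rule applied twice. With \<open>r = 2 * j\<close> and
      \<open>r = 2 * j + 1\<close> it is the recursion of \<open>cheb_W\<close> for each of the two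
      binomial terms.\<close>
    have pascal: "int ((m + 2) choose (r + 2)) + int (m choose (r + 2))
        = int (m choose r) + 2 * int ((m + 1) choose (r + 2))" for m r
      by (simp add: numeral_2_eq_2)
    show ?thesis
      using 3(1)[of j] 3(1)[of k] 3(2)[of k] pascal[of "n + j + 1" "2 * j"] pascal[of "n + j + 1" "2 * j + 1"]
      by (simp add: Suc algebra_simps)
  qed
qed

lemma degree_cheb_W: "degree (cheb_W n) = n"
  by (rule antisym) (auto intro!: degree_le le_degree simp: coeff_cheb_W binomial_eq_0)

lemma prime_dvd_coeff_cheb_W:
  assumes p: "prime (2 * n + 1)" and k: "k < n"
  shows "int (2 * n + 1) dvd coeff (cheb_W n) k"
proof -
  have "(2 * k + 1) * ((n + k) choose (2 * k + 1)) = (n - k) * ((n + k) choose (2 * k))"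
    using binomial_absorb_comp[of "n + k" "2 * k"] times_binomial_minus1_eq[of "2 * k + 1" "n + k"] k
    by (simp add: mult.commute)
  then have "int (2 * k + 1) * int ((n + k) choose (2 * k + 1)) = int (n - k) * int ((n + k) choose (2 * k))"
    by (metis of_nat_mult)
  \<comment> \<open>The factors add up because
    \<open>(2 * k + 1) + 2 * (n - k) = 2 * n + 1\<close>.\<close>
  then have "int (2 * k + 1) * coeff (cheb_W n) k = int (2 * n + 1) * int ((n + k) choose (2 * k))"
    using k by (simp add: coeff_cheb_W algebra_simps of_nat_diff)
  then have "int (2 * n + 1) dvd int (2 * k + 1) * coeff (cheb_W n) k" by simp
  moreover have "\<not> int (2 * n + 1) dvd int (2 * k + 1)"
    using k by (subst int_dvd_int_iff) (auto dest: dvd_imp_le)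
  moreover have "prime (int (2 * n + 1))" using p prime_nat_int_transfer by blast
  ultimately show ?thesis using prime_dvd_multD by blast
qed

lemma irreducible_cheb_W:
  assumes "n > 0" and p: "prime (2 * n + 1)"
  shows "irreducible (cheb_W n)"
proof (rule eisenstein_irreducible)
  show "prime (int (2 * n + 1))" using p prime_nat_int_transfer by blast
  show "lead_coeff (cheb_W n) = 1" by (simp add: degree_cheb_W) (simp add: coeff_cheb_W binomial_eq_0 flip: mult_2)
  show "\<not> (int (2 * n + 1))\<^sup>2 dvd coeff (cheb_W n) 0"
  proof
    assume "(int (2 * n + 1))\<^sup>2 dvd coeff (cheb_W n) 0"
    \<comment> \<open>The constant coefficient is \<open>1 + 2 * n\<close>, the prime
      itself.\<close>
    then have "(int (2 * n + 1))\<^sup>2 dvd int (2 * n + 1)" by (simp add: coeff_cheb_W)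
    then have "(int (2 * n + 1))\<^sup>2 \<le> int (2 * n + 1)" by (rule zdvd_imp_le) simp
    then show False
      using power_strict_increasing[of 1 2 "int (2 * n + 1)"] assms(1) by simp
  qed
qed (use assms prime_dvd_coeff_cheb_W[OF p] degree_cheb_W in auto)

section \<open>Evaluation of polynomials at a square matrix\<close>

text \<open>The value \<open>f(A)\<close> by Horner's scheme; the size is read off from
  \<open>dim_row A\<close>.\<close>

definition mat_of_poly :: "'a::comm_ring_1 mat \<Rightarrow> 'a poly \<Rightarrow> 'a mat" where
  "mat_of_poly A f = fold_coeffs (\<lambda>a B. a \<cdot>\<^sub>m 1\<^sub>m (dim_row A) + A * B) f (0\<^sub>m (dim_row A) (dim_row A))"

context
  fixes A :: "'a::comm_ring_1 mat" and n :: nat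
  assumes A: "A \<in> carrier_mat n n"
begin

lemma mat_of_poly_0 [simp]: "mat_of_poly A 0 = 0\<^sub>m n n"
  using A by (simp add: mat_of_poly_def)

lemma mat_of_poly_pCons:
  "mat_of_poly A (pCons a f) = a \<cdot>\<^sub>m 1\<^sub>m n + A * mat_of_poly A f"
\<comment> \<open>The polynomial \<open>pCons 0 0\<close> has no coefficients to fold over, so this
  Horner step is checked by hand.\<close>
proof (cases "a = 0 \<and> f = 0")
  case True
  have "(0::'a) \<cdot>\<^sub>m 1\<^sub>m n + A * 0\<^sub>m n n = 0\<^sub>m n n"
    using A by (intro eq_matI) auto
  then show ?thesis using A True by (simp add: mat_of_poly_def)
next
  case False
  then show ?thesis using A by (cases "f = 0") (auto simp: mat_of_poly_def)
qed

lemma mat_of_poly_carrier [simp]: "mat_of_poly A f \<in> carrier_mat n n"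
  using A by (induction f) (auto simp: mat_of_poly_pCons)

lemma dim_mat_of_poly [simp]: "dim_row (mat_of_poly A f) = n" "dim_col (mat_of_poly A f) = n"
  using carrier_matD[OF mat_of_poly_carrier] by auto

lemma mat_of_poly_mult_carrier [simp]: "mat_of_poly A f * mat_of_poly A g \<in> carrier_mat n n"
  "A * mat_of_poly A f \<in> carrier_mat n n" "mat_of_poly A f * A \<in> carrier_mat n n"
  using A by (auto intro: mult_carrier_mat[of _ n n])

lemma mat_of_poly_add: "mat_of_poly A (f + g) = mat_of_poly A f + mat_of_poly A g"
proof (induction f g rule: poly_induct2)
  case (pCons a f b g)
  have "A * mat_of_poly A (f + g) = A * mat_of_poly A f + A * mat_of_poly A g"
    using A pCons by (simp add: mult_add_distrib_mat[of _ n n _ n])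
  then show ?case
    using A by (intro eq_matI) (simp_all add: mat_of_poly_pCons algebra_simps)
qed simp

lemma mat_of_poly_smult: "mat_of_poly A (Polynomial.smult c f) = c \<cdot>\<^sub>m mat_of_poly A f"
proof (induction f)
  case (pCons a f)
  have "A * mat_of_poly A (Polynomial.smult c f) = c \<cdot>\<^sub>m (A * mat_of_poly A f)"
    using A pCons by (simp add: mult_smult_distrib[of _ n n _ n])
  then show ?case
    using A by (intro eq_matI) (simp_all add: mat_of_poly_pCons algebra_simps)
qed simp

lemma mat_of_poly_diff: "mat_of_poly A (f - g) = mat_of_poly A f - mat_of_poly A g"
proof -
  have "f - g = f + Polynomial.smult (-1) g" by simp
  then have "mat_of_poly A (f - g) = mat_of_poly A f + (-1) \<cdot>\<^sub>m mat_of_poly A g"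
    by (simp only: mat_of_poly_add mat_of_poly_smult)
  also have "\<dots> = mat_of_poly A f - mat_of_poly A g"
    using carrier_matD[OF mat_of_poly_carrier[of f]] carrier_matD[OF mat_of_poly_carrier[of g]]
    by (intro eq_matI) auto
  finally show ?thesis .
qed

lemma mat_of_poly_mult: "mat_of_poly A (f * g) = mat_of_poly A f * mat_of_poly A g"
proof (induction f)
  case (pCons a f)
  have "mat_of_poly A (pCons a f) * mat_of_poly A g
      = (a \<cdot>\<^sub>m 1\<^sub>m n) * mat_of_poly A g + A * mat_of_poly A f * mat_of_poly A g"
    by (simp add: mat_of_poly_pCons add_mult_distrib_mat[of _ n n _ _ n])
  also have "(a \<cdot>\<^sub>m 1\<^sub>m n) * mat_of_poly A g = a \<cdot>\<^sub>m mat_of_poly A g"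
    by (subst mult_smult_assoc_mat[of _ n n _ n]) auto
  also have "A * mat_of_poly A f * mat_of_poly A g = mat_of_poly A (pCons 0 (f * g))"
    using A pCons by (simp add: mat_of_poly_pCons assoc_mult_mat[of _ n n _ n _ n])
      (intro eq_matI; simp)
  finally show ?case
    by (simp add: mat_of_poly_add mat_of_poly_smult)
qed simp

lemma mat_of_poly_1 [simp]: "mat_of_poly A 1 = 1\<^sub>m n"
  using A by (intro eq_matI) (simp_all add: one_pCons mat_of_poly_pCons)

lemma mat_of_poly_Poly_mult_vec:
  assumes v: "v \<in> carrier_vec n" and j: "j < n"
  shows "(mat_of_poly A (Poly cs) *\<^sub>v v) $ j = (\<Sum>i<length cs. cs ! i * ((A ^\<^sub>m i) *\<^sub>v v) $ j)"
  using v
proof (induction cs arbitrary: v)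
  case Nil
  then show ?case using j by simp
next
  case (Cons c cs)
  have pow: "A ^\<^sub>m i \<in> carrier_mat n n" for i using A by simp
  \<comment> \<open>With the factor x on the right, \<open>A\<close> acts on \<open>v\<close> first,
    and the induction hypothesis applies to \<open>A *\<^sub>v v\<close>.\<close>
  have "pCons c (Poly cs) = [:c:] + Poly cs * [:0, 1:]" by simp
  then have "mat_of_poly A (Poly (c # cs)) = mat_of_poly A [:c:] + mat_of_poly A (Poly cs) * mat_of_poly A [:0, 1:]"
    by (simp only: Poly.simps mat_of_poly_add mat_of_poly_mult)
  moreover have "mat_of_poly A [:c:] = c \<cdot>\<^sub>m 1\<^sub>m n" "mat_of_poly A [:0, 1:] = A"
    using A by (auto simp: mat_of_poly_pCons)
  ultimately have "mat_of_poly A (Poly (c # cs)) *\<^sub>v v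
      = (c \<cdot>\<^sub>m 1\<^sub>m n) *\<^sub>v v + mat_of_poly A (Poly cs) *\<^sub>v (A *\<^sub>v v)"
    using A Cons.prems by (simp add: add_mult_distrib_mat_vec[of _ n n] assoc_mult_mat_vec[of _ n n _ n])
  moreover have "((c \<cdot>\<^sub>m 1\<^sub>m n) *\<^sub>v v) $ j = c * v $ j"
    using Cons.prems j by simp
  moreover have "(mat_of_poly A (Poly cs) *\<^sub>v (A *\<^sub>v v)) $ j
      = (\<Sum>i<length cs. cs ! i * ((A ^\<^sub>m Suc i) *\<^sub>v v) $ j)"
    using A Cons.prems pow by (subst Cons.IH) (auto simp: assoc_mult_mat_vec[of _ n n _ n])
  ultimately show ?case
    using A Cons.prems j carrier_matD[OF mat_of_poly_carrier] by (simp add: sum.lessThan_Suc_shift del: pow_mat.simps(2) sum.lessThan_Suc)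
qed

end

section \<open>Polynomials annihilating a nonzero integer vector\<close>

lemma no_annihilating_poly:
  fixes A :: "int mat"
  assumes A: "A \<in> carrier_mat n n" and E: "irreducible E" "mat_of_poly A E = 0\<^sub>m n n"
    and v: "v \<in> carrier_vec n" "v \<noteq> 0\<^sub>v n"
    and q: "q \<noteq> 0" "degree q < degree E"
  shows "mat_of_poly A q *\<^sub>v v \<noteq> 0\<^sub>v n"
proof
  assume qv: "mat_of_poly A q *\<^sub>v v = 0\<^sub>v n"
  have [simp]: "mat_of_poly A f \<in> carrier_mat n n" for f using A by simp
  define P where "P f \<longleftrightarrow> f \<noteq> 0 \<and> mat_of_poly A f *\<^sub>v v = 0\<^sub>v n" for f
  obtain f where f: "P f" and min: "\<And>g. P g \<Longrightarrow> degree f \<le> degree g"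
    using q qv exists_least_iff[of "\<lambda>d. \<exists>g. P g \<and> degree g = d"] unfolding P_def
    by (metis not_less)
  have "degree f < degree E" using min[of q] q qv by (simp add: P_def)
  \<comment> \<open>Pseudo-division stays in the integers at the price of the factor
    \<open>c\<close>.\<close>
  obtain c g where c: "c \<noteq> 0" "Polynomial.smult c E = f * g + pseudo_mod E f"
    using pseudo_mod(1)[of f E] f by (auto simp: P_def)
  have "mat_of_poly A (pseudo_mod E f) *\<^sub>v v = 0\<^sub>v n"
  proof -
    have "pseudo_mod E f = Polynomial.smult c E - g * f" using c by (simp add: mult.commute)
    then have "mat_of_poly A (pseudo_mod E f) *\<^sub>v v
        = (c \<cdot>\<^sub>m 0\<^sub>m n n) *\<^sub>v v - mat_of_poly A g *\<^sub>v (mat_of_poly A f *\<^sub>v v)"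
      using v by (simp add: mat_of_poly_diff[OF A] mat_of_poly_smult[OF A] mat_of_poly_mult[OF A] E
        minus_mult_distrib_mat_vec[of _ n n] assoc_mult_mat_vec[of _ n n _ n] mat_of_poly_mult_carrier[OF A])
    then show ?thesis using f v A by (auto simp: P_def intro!: eq_vecI)
  qed
  \<comment> \<open>The remainder also annihilates \<open>v\<close>, so minimality of the degree of
    \<open>f\<close> forces it to be 0.\<close>
  then have "\<not> P (pseudo_mod E f) \<Longrightarrow> pseudo_mod E f = 0"
    by (simp add: P_def)
  moreover have "\<not> P (pseudo_mod E f) \<or> pseudo_mod E f = 0"
    using pseudo_mod(2)[of f E] min[of "pseudo_mod E f"] f not_less unfolding P_def by blast
  ultimately have "pseudo_mod E f = 0" by blast
  then have cE: "Polynomial.smult c E = f * g" using c by simp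
  have "prime_elem E" using E(1) by (rule irreducible_imp_prime_elem)
  moreover have "E dvd f * g" by (simp flip: cE add: dvd_smult)
  moreover have "\<not> E dvd f"
    using \<open>degree f < degree E\<close> f dvd_imp_degree_le[of E f] by (auto simp: P_def)
  ultimately obtain h where g: "g = E * h" by (metis prime_elem_dvd_multD dvdE)
  have "E \<noteq> 0" using E by auto
  \<comment> \<open>Cancelling \<open>E\<close> leaves a constant multiple of 1, so \<open>c\<close>
    annihilates \<open>v\<close>, although \<open>c\<close> is nonzero and the entries are
    integers.\<close>
  have "E * (f * h) = E * [:c:]" using cE by (simp add: g algebra_simps)
  then have fh: "f * h = [:c:]" using mult_left_cancel[OF \<open>E \<noteq> 0\<close>] by blast
  have "c \<cdot>\<^sub>v v = mat_of_poly A [:c:] *\<^sub>v v"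
    using A v by (simp add: mat_of_poly_pCons[OF A]) (intro eq_vecI; simp)
  also have "\<dots> = mat_of_poly A h *\<^sub>v (mat_of_poly A f *\<^sub>v v)"
    using v by (simp flip: fh add: mult.commute[of f] mat_of_poly_mult[OF A] assoc_mult_mat_vec[of _ n n _ n])
  also have "\<dots> = 0\<^sub>v n" using f A by (auto simp: P_def scalar_prod_def dim_mat_of_poly[OF A] intro!: eq_vecI)
  finally have "c * v $ i = 0" if "i < n" for i
    using that v by (metis carrier_vecD index_smult_vec(1) index_zero_vec(1))
  then show False using c(1) v by (metis eq_vecI carrier_vecD index_zero_vec mult_eq_0_iff)
qed

section \<open>Action and determinant of the tridiagonal matrix\<close>

lemma tridiag_M_carrier [simp]: "tridiag_M n a \<in> carrier_mat n n"
  by (simp add: tridiag_M_def)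

lemma tridiag_M_mult_vec:
  fixes a :: "'a::ring_1"
  assumes x: "x \<in> carrier_vec n" and i: "i < n"
  shows "(tridiag_M n a *\<^sub>v x) $ i = (if i = n - 1 then a - 1 else a) * x $ i
    + (if i + 1 < n then x $ (i + 1) else 0) + (if i > 0 then x $ (i - 1) else 0)"
proof -
  have "(tridiag_M n a *\<^sub>v x) $ i = (\<Sum>k<n. tridiag_M n a $$ (i, k) * x $ k)"
    using x i by (simp add: scalar_prod_def lessThan_atLeast0 carrier_matD[OF tridiag_M_carrier])
  \<comment> \<open>The guard \<open>i > 0\<close> matters: at \<open>i = 0\<close> the truncated
    \<open>i - 1\<close> would hit the diagonal.\<close>
  also have "\<dots> = (\<Sum>k<n. (if k = i then (if i = n - 1 then a - 1 else a) * x $ k else 0)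
      + (if k = i + 1 then x $ k else 0) + (if i > 0 \<and> k = i - 1 then x $ k else 0))"
    using i by (intro sum.cong) (auto simp: tridiag_M_def)
  also have "\<dots> = (if i = n - 1 then a - 1 else a) * x $ i
    + (if i + 1 < n then x $ (i + 1) else 0) + (if i > 0 then x $ (i - 1) else 0)"
    using i by (cases "i = 0") (auto simp: sum.distrib sum.delta)
  finally show ?thesis .
qed

text \<open>\<open>M\<^sub>n(2)\<close> is the product of a unitriangular matrix and its transpose.\<close>

lemma det_tridiag_M_2: "det (tridiag_M n (2::int)) = 1"
proof -
  define B :: "int mat" where "B = mat n n (\<lambda>(i, j). if j = i \<or> j = i + 1 then 1 else 0)"
  have B: "B \<in> carrier_mat n n" by (simp add: B_def)
  have "tridiag_M n 2 = B * transpose_mat B"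
  proof (rule eq_matI)
    fix i j assume "i < dim_row (B * transpose_mat B)" "j < dim_col (B * transpose_mat B)"
    then have ij: "i < n" "j < n" using B by auto
    have "(B * transpose_mat B) $$ (i, j) = (\<Sum>k<n. B $$ (i, k) * B $$ (j, k))"
      using ij B by (simp add: scalar_prod_def lessThan_atLeast0)
    \<comment> \<open>Row \<open>i\<close> of \<open>B\<close> lives in columns \<open>i\<close> and
      \<open>i + 1\<close>. In the last row the second is missing, so the last diagonal entry is 1
      instead of 2.\<close>
    also have "\<dots> = (\<Sum>k<n. (if k = i then if j = i \<or> i = j + 1 then 1 else 0 else 0)
        + (if k = i + 1 then if i = j \<or> i + 1 = j then 1 else 0 else 0))"
      using ij by (intro sum.cong) (auto simp: B_def)
    finally show "tridiag_M n 2 $$ (i, j) = (B * transpose_mat B) $$ (i, j)"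
      using ij by (auto simp: sum.distrib sum.delta tridiag_M_def)
  qed (use B in \<open>auto simp: tridiag_M_def\<close>)
  moreover have "det B = 1"
  proof -
    have "diag_mat B = replicate n 1"
      using B by (intro nth_equalityI) (auto simp: B_def diag_mat_def)
    moreover have "upper_triangular B"
      by (auto simp: B_def upper_triangular_def)
    ultimately show ?thesis
      using B by (simp add: det_upper_triangular[of _ n])
  qed
  ultimately show ?thesis
    using B by (simp add: det_mult[of _ n] det_transpose[of _ n])
qed

text \<open>The adjugate is an integer matrix, and for determinant 1 it is the inverse.\<close>

lemma mem_GL_int_if_det_1:
  assumes A: "A \<in> carrier_mat n n" and det: "det A = 1"
  shows "A \<in> GL_int n"
proof -
  have "A * adj_mat A = 1\<^sub>m n" "adj_mat A * A = 1\<^sub>m n" "adj_mat A \<in> carrier_mat n n"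
    using adj_mat[OF A] by (auto simp: det)
  then have "invertible_mat A"
    using A unfolding invertible_mat_def inverts_mat_def by auto
  then show ?thesis using A by (simp add: GL_int_def)
qed

section \<open>The matrix \<open>M\<^sub>n(2)\<close> is a root of
  \<open>W\<^sub>n(x - 4)\<close>\<close>

text \<open>Setting y = x - 4 turns \<open>W\<^sub>j(N)\<close> into a polynomial in
  \<open>M\<close>; the factors y + 3 and y + 2 become x - 1 and x - 2.\<close>

abbreviation cheb_W_shift :: "nat \<Rightarrow> int poly" where
  "cheb_W_shift j \<equiv> pcompose (cheb_W j) [:-4, 1:]"

lemma cheb_W_shift_Suc_Suc:
  "cheb_W_shift (Suc (Suc j)) = pCons 0 (cheb_W_shift (Suc j)) - Polynomial.smult 2 (cheb_W_shift (Suc j)) - cheb_W_shift j"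
  unfolding cheb_W.simps pcompose_diff pcompose_mult by (simp add: pcompose_pCons)

lemma mat_of_poly_cheb_W_shift_Suc_Suc:
  fixes A :: "int mat"
  assumes A: "A \<in> carrier_mat n n" and v: "v \<in> carrier_vec n"
  shows "mat_of_poly A (cheb_W_shift (Suc (Suc j))) *\<^sub>v v
    = A *\<^sub>v (mat_of_poly A (cheb_W_shift (Suc j)) *\<^sub>v v)
      - 2 \<cdot>\<^sub>v (mat_of_poly A (cheb_W_shift (Suc j)) *\<^sub>v v) - mat_of_poly A (cheb_W_shift j) *\<^sub>v v"
proof -
  let ?F = "mat_of_poly A"
  note [simp] = mat_of_poly_carrier[OF A] mat_of_poly_mult_carrier[OF A]
  have "?F (pCons 0 f) = A * ?F f" for f
    using A by (intro eq_matI) (auto simp: mat_of_poly_pCons[OF A])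
  then have "?F (cheb_W_shift (Suc (Suc j)))
      = A * ?F (cheb_W_shift (Suc j)) - 2 \<cdot>\<^sub>m ?F (cheb_W_shift (Suc j)) - ?F (cheb_W_shift j)"
    by (simp add: cheb_W_shift_Suc_Suc mat_of_poly_diff[OF A] mat_of_poly_smult[OF A] del: cheb_W.simps)
  moreover have "(2 \<cdot>\<^sub>m ?F f) *\<^sub>v v = 2 \<cdot>\<^sub>v (?F f *\<^sub>v v)" for f
    using v by (intro eq_vecI) (auto simp: mat_of_poly_carrier[OF A, THEN carrier_matD(2)])
  ultimately show ?thesis
    using A v by (simp add: minus_mult_distrib_mat_vec[of _ n n] assoc_mult_mat_vec[of _ n n _ n] minus_carrier_mat del: cheb_W.simps)
qed

lemma mat_of_poly_cheb_W_shift_1: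
  fixes A :: "int mat"
  assumes A: "A \<in> carrier_mat n n" and v: "v \<in> carrier_vec n"
  shows "mat_of_poly A (cheb_W_shift (Suc 0)) *\<^sub>v v = A *\<^sub>v v - v"
proof -
  have "mat_of_poly A (cheb_W_shift (Suc 0)) = A - 1\<^sub>m n"
    using A by (intro eq_matI) (auto simp: pcompose_pCons mat_of_poly_pCons[OF A] dim_mat_of_poly[OF A])
  then show ?thesis
    using A v by (simp add: minus_mult_distrib_mat_vec[of _ n n])
qed

text \<open>Write \<open>f\<^sub>j\<close> for the vector on the right, with
  \<open>f\<^sub>0 = e\<^sub>0\<close>. Away from the last column \<open>M - 2\<close> sends each
  unit vector to the sum of its neighbours, so \<open>(M - 2) f\<^sub>j\<^sub>+\<^sub>1 =
  f\<^sub>j\<^sub>+\<^sub>2 + f\<^sub>j\<close>, which is the recursion.\<close>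

lemma mat_of_poly_cheb_W_shift_mult_unit_vec:
  assumes "j < n"
  shows "mat_of_poly (tridiag_M n 2) (cheb_W_shift j) *\<^sub>v unit_vec n 0
    = vec n (\<lambda>i. if i = j \<or> i + 1 = j then 1 else 0)"
  using assms
proof (induction j rule: cheb_W.induct)
  case 1
  then show ?case
    by (simp add: pcompose_1 mat_of_poly_1[of _ n]) (intro eq_vecI; simp)
next
  case 2
  show ?case
    using 2 unfolding mat_of_poly_cheb_W_shift_1[OF tridiag_M_carrier unit_vec_carrier]
    by (intro eq_vecI) (auto simp: tridiag_M_mult_vec simp del: index_mult_mat_vec)
next
  case (3 j)
  have IH: "mat_of_poly (tridiag_M n 2) (cheb_W_shift (Suc j)) *\<^sub>v unit_vec n 0
      = vec n (\<lambda>i. if i = Suc j \<or> i + 1 = Suc j then 1 else 0)"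
    "mat_of_poly (tridiag_M n 2) (cheb_W_shift j) *\<^sub>v unit_vec n 0
      = vec n (\<lambda>i. if i = j \<or> i + 1 = j then 1 else 0)"
    by (rule "3.IH", use "3.prems" in simp)+
  show ?case
    unfolding mat_of_poly_cheb_W_shift_Suc_Suc[OF tridiag_M_carrier unit_vec_carrier] IH
  proof (rule eq_vecI)
    let ?f = "\<lambda>j. vec n (\<lambda>i. if i = j \<or> i + 1 = j then 1 else 0) :: int vec"
    fix i assume "i < dim_vec (?f (Suc (Suc j)))"
    then have i: "i < n" by simp
    then have "(tridiag_M n 2 *\<^sub>v ?f (Suc j)) $ i
        = 2 * ?f (Suc j) $ i + ?f j $ i + ?f (Suc (Suc j)) $ i"
      using "3.prems" by (cases i) (auto simp: tridiag_M_mult_vec simp del: index_mult_mat_vec)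
    then show "(tridiag_M n 2 *\<^sub>v ?f (Suc j) - 2 \<cdot>\<^sub>v ?f (Suc j) - ?f j) $ i = ?f (Suc (Suc j)) $ i"
      using i by (simp del: index_mult_mat_vec)
  qed (simp add: carrier_matD[OF tridiag_M_carrier])
qed

text \<open>For n > 1, the corner entry of \<open>M - 2\<close> is -1 and cancels the neighbour
  contributed by \<open>e\<^sub>n\<^sub>-\<^sub>2\<close>; hence \<open>(M - 2)
  f\<^sub>n\<^sub>-\<^sub>1 = f\<^sub>n\<^sub>-\<^sub>2\<close> and the recursion ends in 0.\<close>

lemma mat_of_poly_cheb_W_shift_mult_unit_vec_0:
  assumes "n > 0"
  shows "mat_of_poly (tridiag_M n 2) (cheb_W_shift n) *\<^sub>v unit_vec n 0 = 0\<^sub>v n"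
proof (cases n rule: cheb_W.cases)
  case 2
  show ?thesis
    unfolding 2 mat_of_poly_cheb_W_shift_1[OF tridiag_M_carrier unit_vec_carrier]
    by (intro eq_vecI) (auto simp: tridiag_M_mult_vec simp del: index_mult_mat_vec)
next
  case (3 j)
  have IH: "mat_of_poly (tridiag_M n 2) (cheb_W_shift (Suc j)) *\<^sub>v unit_vec n 0
      = vec n (\<lambda>i. if i = Suc j \<or> i + 1 = Suc j then 1 else 0)"
    "mat_of_poly (tridiag_M n 2) (cheb_W_shift j) *\<^sub>v unit_vec n 0
      = vec n (\<lambda>i. if i = j \<or> i + 1 = j then 1 else 0)"
    using 3 by (simp_all only: mat_of_poly_cheb_W_shift_mult_unit_vec)
  have "mat_of_poly (tridiag_M n 2) (cheb_W_shift (Suc (Suc j))) *\<^sub>v unit_vec n 0 = 0\<^sub>v n"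
    unfolding mat_of_poly_cheb_W_shift_Suc_Suc[OF tridiag_M_carrier unit_vec_carrier] IH
    using 3 by (intro eq_vecI) (auto simp: tridiag_M_mult_vec simp del: index_mult_mat_vec)
  then show ?thesis using 3 by metis
qed (use assms in simp)

lemma mat_of_poly_cheb_W_shift_eq_0:
  assumes n: "n > 0"
  shows "mat_of_poly (tridiag_M n 2) (cheb_W_shift n) = 0\<^sub>m n n"
proof -
  let ?F = "mat_of_poly (tridiag_M n (2::int))"
  have [simp]: "?F f \<in> carrier_mat n n" for f by (rule mat_of_poly_carrier[OF tridiag_M_carrier])
  have mult: "?F (f * g) = ?F f * ?F g" for f g by (rule mat_of_poly_mult[OF tridiag_M_carrier])
  \<comment> \<open>Polynomials in \<open>M\<close> commute, so what kills \<open>e\<^sub>0\<close>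
    also kills \<open>W\<^sub>j(N) e\<^sub>0\<close>; these vectors yield all unit vectors
    successively.\<close>
  have sum: "?F (cheb_W_shift n) *\<^sub>v vec n (\<lambda>i. if i = j \<or> i + 1 = j then 1 else 0) = 0\<^sub>v n" if "j < n" for j
  proof -
    have "?F (cheb_W_shift n) *\<^sub>v vec n (\<lambda>i. if i = j \<or> i + 1 = j then 1 else 0)
        = ?F (cheb_W_shift n * cheb_W_shift j) *\<^sub>v unit_vec n 0"
      using that by (simp add: mult assoc_mult_mat_vec[of _ n n _ n] mat_of_poly_cheb_W_shift_mult_unit_vec)
    also have "\<dots> = ?F (cheb_W_shift j) *\<^sub>v 0\<^sub>v n"
      by (simp add: mult.commute[of "cheb_W_shift n"] mult assoc_mult_mat_vec[of _ n n _ n]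
          mat_of_poly_cheb_W_shift_mult_unit_vec_0[OF n])
    also have "\<dots> = 0\<^sub>v n" by (intro eq_vecI) (auto simp: scalar_prod_def dim_mat_of_poly[OF tridiag_M_carrier])
    finally show ?thesis .
  qed
  have unit: "?F (cheb_W_shift n) *\<^sub>v unit_vec n j = 0\<^sub>v n" if "j < n" for j
    using that
  proof (induction j)
    case 0
    show ?case by (rule mat_of_poly_cheb_W_shift_mult_unit_vec_0[OF n])
  next
    case (Suc j)
    have "vec n (\<lambda>i. if i = Suc j \<or> i + 1 = Suc j then 1 else 0) = (unit_vec n (Suc j) :: int vec) + unit_vec n j"
      using Suc.prems by (intro eq_vecI) auto
    then have "?F (cheb_W_shift n) *\<^sub>v unit_vec n (Suc j) + ?F (cheb_W_shift n) *\<^sub>v unit_vec n j = 0\<^sub>v n"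
      using sum[OF Suc.prems] by (simp add: mult_add_distrib_mat_vec[of _ n n])
    moreover have "?F (cheb_W_shift n) *\<^sub>v unit_vec n (Suc j) \<in> carrier_vec n"
      by (rule mult_mat_vec_carrier[of _ n n]) simp_all
    ultimately show ?case using Suc by simp
  qed
  show ?thesis
  proof (rule eq_matI)
    fix i j assume "i < dim_row (0\<^sub>m n n)" "j < dim_col (0\<^sub>m n n)"
    then have ij: "i < n" "j < n" by auto
    then have "?F (cheb_W_shift n) $$ (i, j) = (?F (cheb_W_shift n) *\<^sub>v unit_vec n j) $ i"
      by (simp add: dim_mat_of_poly[OF tridiag_M_carrier])
    then show "?F (cheb_W_shift n) $$ (i, j) = 0\<^sub>m n n $$ (i, j)"
      using ij by (simp add: unit)
  qed auto
qed

section \<open>From an integer determinant to strong independence\<close>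

text \<open>The determinant stays nonzero over the reals, which excludes both repeated and dependent
  columns. Column \<open>j\<close> holds the vector of index \<open>Suc j\<close>, as the family
  starts at 1.\<close>

lemma real_lin_indpt_family_if_det_nonzero:
  fixes v :: "nat \<Rightarrow> int vec"
  assumes v: "\<And>i. i \<in> {1..n} \<Longrightarrow> v i \<in> carrier_vec n"
    and det: "det (mat n n (\<lambda>(r, j). v (Suc j) $ r)) \<noteq> 0"
  shows "real_lin_indpt_family n {1..n} (\<lambda>i. map_vec real_of_int (v i))"
proof -
  let ?A = "mat n n (\<lambda>(r, j). v (Suc j) $ r)"
  let ?R = "map_mat real_of_int ?A"
  have R: "?R \<in> carrier_mat n n" by simp
  have detR: "det ?R \<noteq> 0" using det by (simp add: of_int_hom.hom_det)
  have col: "map_vec real_of_int (v (Suc j)) = col ?R j" if "j < n" for j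
    using that v[of "Suc j"] by (intro eq_vecI) auto
  have "(\<lambda>i. map_vec real_of_int (v i)) ` {1..n} = (\<lambda>j. map_vec real_of_int (v (Suc j))) ` {..<n}"
    unfolding image_Suc_lessThan[symmetric] image_image ..
  also have "\<dots> = set (cols ?R)"
    by (simp add: col cols_def lessThan_atLeast0)
  finally have "(\<lambda>i. map_vec real_of_int (v i)) ` {1..n} = set (cols ?R)" .
  moreover have "inj_on (\<lambda>i. map_vec real_of_int (v i)) {1..n}"
  proof (rule inj_onI, rule ccontr)
    fix i j assume ij: "i \<in> {1..n}" "j \<in> {1..n}" "map_vec real_of_int (v i) = map_vec real_of_int (v j)" "i \<noteq> j"
    then have "i - 1 \<noteq> j - 1" "i - 1 < n" "j - 1 < n" "col ?R (i - 1) = col ?R (j - 1)"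
      using col[of "i - 1"] col[of "j - 1"] by auto
    with det_identical_columns[OF R] detR show False by blast
  qed
  ultimately show ?thesis
    using idom_vec.lin_dep_cols_imp_det_0[OF R] detR
    unfolding real_lin_indpt_family_def by auto
qed

lemma pow_mat_Suc_left:
  assumes "A \<in> carrier_mat n n"
  shows "A ^\<^sub>m Suc i = A * A ^\<^sub>m i"
proof (induction i)
  case (Suc i)
  have "A ^\<^sub>m Suc (Suc i) = A * A ^\<^sub>m i * A"
    using Suc by simp
  also have "\<dots> = A * A ^\<^sub>m Suc i"
    using assms by (simp add: assoc_mult_mat[of _ n n _ n _ n])
  finally show ?case .
qed (use assms in simp)

text \<open>Symmetry lets the row vectors \<open>k M\<^sup>i\<close> be treated as column vectors
  \<open>M\<^sup>i k\<close>.\<close>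

lemma transpose_tridiag_M_pow: "transpose_mat (tridiag_M n (a::'a::comm_ring_1) ^\<^sub>m i) = tridiag_M n a ^\<^sub>m i"
proof (induction i)
  case (Suc i)
  have "transpose_mat (tridiag_M n a) = tridiag_M n a"
    by (intro eq_matI) (auto simp: tridiag_M_def)
  then have "transpose_mat (tridiag_M n a ^\<^sub>m Suc i) = tridiag_M n a * tridiag_M n a ^\<^sub>m i"
    using Suc by (simp add: transpose_mult[of _ n n _ n])
  also have "\<dots> = tridiag_M n a ^\<^sub>m Suc i"
    by (rule pow_mat_Suc_left[OF tridiag_M_carrier, symmetric])
  finally show ?case .
qed (auto simp: tridiag_M_def)

lemma row_vec_mult_eq_transpose:
  fixes A :: "'a::comm_semiring_0 mat"
  assumes "A \<in> carrier_mat n m" "k \<in> carrier_vec n"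
  shows "row_vec_mult k A = transpose_mat A *\<^sub>v k"
  using assms by (intro eq_vecI) (auto simp: row_vec_mult_def intro: comm_scalar_prod)

theorem theorem1p5:
  fixes n :: nat
  assumes "n > 0" and "prime (2 * n + 1)"
  shows "strongly_independent n (\<lambda>i. tridiag_M n 2 ^\<^sub>m i)"
  unfolding strongly_independent_def
proof (intro conjI ballI impI)
  let ?M = "tridiag_M n (2::int)"
  have M: "?M \<in> carrier_mat n n" by simp
  have pow [simp]: "?M ^\<^sub>m i \<in> carrier_mat n n" for i by simp
  have detpow: "det (?M ^\<^sub>m i) = 1" for i
    by (induction i) (simp_all add: det_mult[of _ n] det_tridiag_M_2)
  show "?M ^\<^sub>m i \<in> GL_int n" for i
    by (rule mem_GL_int_if_det_1[OF pow detpow])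
  fix k :: "int vec" assume k: "k \<in> carrier_vec n" "k \<noteq> 0\<^sub>v n"
  have row: "row_vec_mult k (?M ^\<^sub>m i) = ?M ^\<^sub>m i *\<^sub>v k" for i
    using row_vec_mult_eq_transpose[OF pow k(1)] by (simp add: transpose_tridiag_M_pow)
  show "real_lin_indpt_family n {1..n} (\<lambda>i. map_vec real_of_int (row_vec_mult k (?M ^\<^sub>m i)))"
    unfolding row
  proof (rule real_lin_indpt_family_if_det_nonzero)
    let ?A = "mat n n (\<lambda>(r, j). (?M ^\<^sub>m Suc j *\<^sub>v k) $ r)"
    have A: "?A \<in> carrier_mat n n" by simp
    show "det ?A \<noteq> 0"
    proof
      assume "det ?A = 0"
      then obtain c where c: "c \<in> carrier_vec n" "c \<noteq> 0\<^sub>v n" "?A *\<^sub>v c = 0\<^sub>v n"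
        using det_0_iff_vec_prod_zero[OF A] by blast
      \<comment> \<open>The entries of the integer kernel vector become coefficients. Since the
        powers start at 1, one factor \<open>M\<close> is absorbed into the vector:
        \<open>q(M)\<close> annihilates \<open>M k\<close>.\<close>
      define q where "q = Poly (list_of_vec c)"
      have Mk: "?M *\<^sub>v k \<in> carrier_vec n" "?M ^\<^sub>m i *\<^sub>v (?M *\<^sub>v k) = ?M ^\<^sub>m Suc i *\<^sub>v k" for i
        using k by (simp_all add: mult_mat_vec_carrier[OF M] assoc_mult_mat_vec[of _ n n _ n])
      have Mq: "mat_of_poly ?M q *\<^sub>v (?M *\<^sub>v k) = 0\<^sub>v n"
      proof (rule eq_vecI)
        fix j assume "j < dim_vec (0\<^sub>v n)"
        then have j: "j < n" by simp
        have "(mat_of_poly ?M q *\<^sub>v (?M *\<^sub>v k)) $ j = (\<Sum>i<n. c $ i * ((?M ^\<^sub>m Suc i) *\<^sub>v k) $ j)"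
          unfolding q_def using k c j
          by (subst mat_of_poly_Poly_mult_vec[OF M]) (simp_all add: list_of_vec_index Mk)
        also have "\<dots> = (?A *\<^sub>v c) $ j"
          using c(1) j by (auto simp: scalar_prod_def lessThan_atLeast0 mult.commute
              simp del: pow_mat.simps intro!: sum.cong)
        finally show "(mat_of_poly ?M q *\<^sub>v (?M *\<^sub>v k)) $ j = 0\<^sub>v n $ j"
          unfolding c(3) .
      qed (simp add: dim_mat_of_poly[OF M])
      have "?M *\<^sub>v k \<noteq> 0\<^sub>v n"
        using det_0_iff_vec_prod_zero[OF M] det_tridiag_M_2[of n] k by auto
      moreover have "q \<noteq> 0"
      proof
        assume "q = 0"
        then have "nth_default 0 (list_of_vec c) i = 0" for i
          by (metis q_def coeff_Poly_eq coeff_0)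
        then have "c $ i = 0" if "i < n" for i
          using that c(1) by (metis nth_default_nth length_list_of_vec list_of_vec_index carrier_vecD)
        then show False using c by auto
      qed
      \<comment> \<open>As \<open>c\<close> has \<open>n\<close> entries, \<open>q\<close> has
        degree at most \<open>n - 1\<close>, below the degree of the irreducible polynomial.\<close>
      moreover have "coeff q i = 0" if "i > n - 1" for i
        using that c(1) by (simp add: q_def nth_default_beyond)
      then have "degree q < degree (cheb_W_shift n)"
        using assms(1) degree_le[of "n - 1" q] by (simp add: degree_pcompose degree_cheb_W)
      ultimately show False
        using no_annihilating_poly[OF M irreducible_pcompose_shift[OF irreducible_cheb_W[OF assms]]
            mat_of_poly_cheb_W_shift_eq_0[OF assms(1)], of "?M *\<^sub>v k" q] Mk(1) Mq by blast
    qed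
  qed (rule mult_mat_vec_carrier[OF pow k(1)])
qed

end
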